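(* Let $\{f\}\in\Delta(X)$ be such that $f_n$ is almost continuous for all $n$, and let $\epsilon>0$. There exist $\delta>0$, $\sigma>0$ and $K<\infty$, all depending on $\{f\}$ and $\epsilon$, such that for every $\{g\}\in\mathcal N_{\delta;\sigma}(\{f\})$ with $\{g\}\in\Delta(X)$, every $n>K$ and every $x\in X$, $$\frac1n g_n(x)<\Lambda(f)+\epsilon\max\{\|g_1\|_\infty,1\}.$$
   Context: $X$ is a compact metric space (distance written $|x-y|$) and $R:X\to X$ is a continuous uniquely ergodic map with unique invariant Borel probability measure $\mu$. A function on $X$ is almost continuous if the closure of its set of discontinuities has $\mu$-measure zero. $\mathbb B_\infty(X)$ is the space of bounded (real) functions on $X$ with $\|f\|_\infty=\sup_{x\in X}|f(x)|$ (a genuine supremum; null sets are not ignored). For $D\subset X$, $\|f\|_{D,\infty}=\sup_{x\in D}|f(x)|$. A subadditive cocycle $\{f\}$ is a sequence of functions $f_1,f_2,\dots$ on $X$ with $f_{n+m}(x)\le f_n(x)+f_m(R^nx)$ for all $n,m\geq 1$, $x\in X$. $\Delta(X)$ is the set of all subadditive cocycles $\{f\}$ with $f_n\in\mathbb B_\infty(X)$ for all $n$. $\Lambda(f)=\lim_{n\to\infty}\frac1n\int_Xf_n\,d\mu$, which is taken to be finite. $E_n=E_n(\{f\})$ is the closure of the set of discontinuities of $f_n$; $B_\delta(E)=\{x\in X:\exists e\in E,\ |x-e|<\delta\}$; $D_n=X\setminus\overline{B_\delta(E_n(\{f\}))}$; $$d_\delta(\{g\},\{f\})=\sum_{n\ge1}\frac1{2^n}\frac{\|g_n-f_n\|_{D_n,\infty}}{1+\|g_n-f_n\|_{D_n,\infty}},\qquad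 \mathcal N_{\delta;\sigma}(\{f\})=\{\{g\}:d_\delta(\{f\},\{g\})<\sigma\},$$ where $D_n$ is always defined by the discontinuity sets of the center $\{f\}$ of the neighborhood. *)

theory Defs
  imports "HOL-Probability.Probability"
begin

definition invariant_prob :: "('a::metric_space \<Rightarrow> 'a) \<Rightarrow> 'a measure \<Rightarrow> bool" where
  "invariant_prob R M \<longleftrightarrow> prob_space M \<and> sets M = sets borel \<and> distr M borel R = M"

definition uniquely_ergodic :: "('a::metric_space \<Rightarrow> 'a) \<Rightarrow> 'a measure \<Rightarrow> bool" where
  "uniquely_ergodic R M \<longleftrightarrow> invariant_prob R M \<and> (\<forall>N. invariant_prob R N \<longrightarrow> N = M)"

definition discontinuities :: "('a::metric_space \<Rightarrow> real) \<Rightarrow> 'a set" where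
  "discontinuities f = {x. \<not> isCont f x}"

definition almost_continuous :: "'a::metric_space measure \<Rightarrow> ('a \<Rightarrow> real) \<Rightarrow> bool" where
  "almost_continuous M f \<longleftrightarrow> closure (discontinuities f) \<in> null_sets M"

text \<open>The supremum over the empty set, which is unspecified for type \<^typ>\<open>real\<close>, is taken to be 0.\<close>

definition sup_norm_on :: "'a set \<Rightarrow> ('a \<Rightarrow> real) \<Rightarrow> real" where
  "sup_norm_on D f = (if D = {} then 0 else (SUP x\<in>D. \<bar>f x\<bar>))"

text \<open>A sequence of functions \<open>f\<^sub>1, f\<^sub>2, \<dots>\<close> is rendered as a function on \<^typ>\<open>nat\<close>, whose value at
  index 0 is ignored throughout.\<close>

definition subadditive_cocycle :: "('a \<Rightarrow> 'a) \<Rightarrow> (nat \<Rightarrow> 'a \<Rightarrow> real) \<Rightarrow> bool" where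
  "subadditive_cocycle R f \<longleftrightarrow>
     (\<forall>n\<ge>1. \<forall>m\<ge>1. \<forall>x. f (n + m) x \<le> f n x + f m ((R ^^ n) x))"

definition bounded_cocycles :: "('a \<Rightarrow> 'a) \<Rightarrow> (nat \<Rightarrow> 'a \<Rightarrow> real) set" where
  "bounded_cocycles R = {f. subadditive_cocycle R f \<and> (\<forall>n\<ge>1. bounded (range (f n)))}"

text \<open>An almost continuous function need not be Borel measurable, but it is measurable with respect
  to the completion of the measure; the integral is therefore taken there. (The Bochner integral
  of a non-measurable function is 0 by convention.)\<close>

definition mean_integral :: "'a measure \<Rightarrow> (nat \<Rightarrow> 'a \<Rightarrow> real) \<Rightarrow> nat \<Rightarrow> real" where
  "mean_integral M f n = (1 / real n) * (\<integral>x. f n x \<partial>completion M)"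

definition Lambda :: "'a measure \<Rightarrow> (nat \<Rightarrow> 'a \<Rightarrow> real) \<Rightarrow> real" where
  "Lambda M f = lim (mean_integral M f)"

definition open_nbhd :: "real \<Rightarrow> 'a::metric_space set \<Rightarrow> 'a set" where
  "open_nbhd \<delta> E = {x. \<exists>e\<in>E. dist x e < \<delta>}"

definition good_set :: "real \<Rightarrow> (nat \<Rightarrow> 'a::metric_space \<Rightarrow> real) \<Rightarrow> nat \<Rightarrow> 'a set" where
  "good_set \<delta> f n = UNIV - closure (open_nbhd \<delta> (closure (discontinuities (f n))))"

text \<open>Not symmetric in its two cocycle arguments: the discontinuity sets are those of the first one,
  the centre \<open>f\<close>. The index is shifted, so that the sum runs over \<open>n \<ge> 1\<close>.\<close>

definition cocycle_dist ::
    "real \<Rightarrow> (nat \<Rightarrow> 'a::metric_space \<Rightarrow> real) \<Rightarrow> (nat \<Rightarrow> 'a \<Rightarrow> real) \<Rightarrow> real" where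
  "cocycle_dist \<delta> f g =
     (\<Sum>k. let n = Suc k; r = sup_norm_on (good_set \<delta> f n) (\<lambda>x. g n x - f n x)
          in (1 / 2 ^ n) * (r / (1 + r)))"

definition cocycle_nbhd ::
    "real \<Rightarrow> real \<Rightarrow> (nat \<Rightarrow> 'a::metric_space \<Rightarrow> real) \<Rightarrow> (nat \<Rightarrow> 'a \<Rightarrow> real) set" where
  "cocycle_nbhd \<delta> \<sigma> f = {g. cocycle_dist \<delta> f g < \<sigma>}"

end

(*
  For fixed N the function g_N is controlled by continuous functions. Off a small neighbourhood of
  the discontinuities of f_N it is at most f_N + eta, by closeness of g to f; on that neighbourhood
  it is at most N C with C = max (sup |g_1|) 1, by subadditivity. With a continuous bump phi that
  is 1 near the discontinuities and has small integral, this gives everywhere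
    g_N <= (1 - phi) f_N + eta + (M + N C) phi,   M = sup |f_N|,
  where (1 - phi) f_N and phi are continuous and do not depend on g. Cutting an orbit of length n
  into blocks of length N, and averaging over the N possible starting points of the blocks, bounds
  N g_n by the Birkhoff sum along R (not R^N, which need not be uniquely ergodic) of the right-hand
  side. Unique ergodicity makes the Birkhoff averages of the two continuous functions converge
  uniformly.

  If uniform convergence failed, empirical measures along the bad orbit segments would accumulate
  at a second invariant probability measure. The accumulation point is a positive functional on all
  bounded functions, hence a finitely additive set function, which is regularised to a Borel
  measure by the content construction.
*)
theory Submission
  imports Defs
begin

section \<open>From finitely additive set functions to Borel measures\<close>

text \<open>Normality separates the disjoint closed sets \<open>K - U\<close> and
  \<open>K - V\<close>; cutting each separating open set out of \<open>K\<close> leaves the two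
  pieces.\<close>

lemma closed_subset_Un_split:
  fixes K :: "'a::t4_space set"
  assumes "closed K" "open U" "open V" "K \<subseteq> U \<union> V"
  obtains K1 K2 where "closed K1" "closed K2" "K1 \<subseteq> U" "K2 \<subseteq> V" "K = K1 \<union> K2"
proof -
  have "closed (K - U)" "closed (K - V)" "(K - U) \<inter> (K - V) = {}"
    using assms by auto
  then obtain W1 W2 where W: "open W1" "open W2" "K - U \<subseteq> W1" "K - V \<subseteq> W2" "W1 \<inter> W2 = {}"
    using t4_space by metis
  show ?thesis
  proof
    show "closed (K - W1)" "closed (K - W2)" using assms W by auto
    show "K - W1 \<subseteq> U" "K - W2 \<subseteq> V" "K = (K - W1) \<union> (K - W2)" using W by auto
  qed
qed

text \<open>Caratheodory's construction. Only an inequality on open sets survives the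
  regularisation, but with the exact total mass it is enough: the Riesz argument recovers equality
  by passing from a function \<open>u\<close> to \<open>1 - u\<close>.\<close>

lemma Borel_measure_of_content:
  fixes m :: "'a::metric_space set \<Rightarrow> ennreal"
  assumes cpt: "compact (UNIV :: 'a set)"
    and empty: "m {} = 0" and fin: "m UNIV < \<top>"
    and mono: "\<And>A B. A \<subseteq> B \<Longrightarrow> m A \<le> m B"
    and add: "\<And>A B. A \<inter> B = {} \<Longrightarrow> m (A \<union> B) = m A + m B"
  obtains N where "sets N = sets borel" "emeasure N UNIV = m UNIV"
    "\<And>U. open U \<Longrightarrow> emeasure N U \<le> m U"
proof -
  \<comment> \<open>\<open>m\<close> is only finitely additive, so its values on open sets may exceed those of the measure
    (mass escaping towards the boundary): regularise from inside, then from outside.\<close>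
  define lam where "lam U = (SUP K\<in>{K. closed K \<and> K \<subseteq> U}. m K)" for U
  define nu where "nu A = (INF U\<in>{U. open U \<and> A \<subseteq> U}. lam U)" for A
  have m_le_lam: "m K \<le> lam U" if "closed K" "K \<subseteq> U" for K U
    unfolding lam_def using that by (intro SUP_upper) auto
  have lam_le_m: "lam U \<le> m U" for U
    unfolding lam_def by (intro SUP_least mono) auto
  have lam_mono: "lam U \<le> lam V" if "U \<subseteq> V" for U V
    unfolding lam_def using that by (intro SUP_subset_mono) auto
  have nu_le: "nu A \<le> lam U" if "open U" "A \<subseteq> U" for A U
    unfolding nu_def using that by (intro INF_lower) auto
  have nu_open: "nu U = lam U" if "open U" for U
    using that by (intro antisym nu_le) (auto simp: nu_def intro!: INF_greatest lam_mono)
  have nu_mono: "nu A \<le> nu B" if "A \<subseteq> B" for A B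
    unfolding nu_def using that by (intro INF_superset_mono) auto
  have lam_fin: "lam U < \<top>" for U
    using lam_le_m[of U] mono[of U UNIV] fin by (metis order.strict_trans1 subset_UNIV)
  have subadd: "m (A \<union> B) \<le> m A + m B" for A B
  proof -
    have "m (A \<union> B) = m A + m (B - A)" using add[of A "B - A"] by (simp add: Un_Diff_cancel)
    also have "\<dots> \<le> m A + m B" by (intro add_mono mono) auto
    finally show ?thesis .
  qed
  have fin_cover: "m K \<le> (\<Sum>i<n. lam (U i))"
    if "closed K" and op: "\<And>i. open (U i)" and "K \<subseteq> (\<Union>i<n. U i)" for K U and n :: nat
    using that(1,3)
  proof (induction n arbitrary: K)
    case 0
    then show ?case by (simp add: empty)
  next
    case (Suc n)
    have V: "open (\<Union>i<n. U i)" using op by auto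
    have sub: "K \<subseteq> (\<Union>i<n. U i) \<union> U n" using Suc.prems by (fastforce simp: less_Suc_eq)
    obtain K1 K2 where K: "closed K1" "closed K2" "K1 \<subseteq> (\<Union>i<n. U i)" "K2 \<subseteq> U n" "K = K1 \<union> K2"
      by (rule closed_subset_Un_split[OF Suc.prems(1) V op sub])
    have "m K \<le> m K1 + m K2" using K subadd by simp
    also have "\<dots> \<le> (\<Sum>i<n. lam (U i)) + lam (U n)"
      using Suc.IH K m_le_lam by (intro add_mono) auto
    finally show ?case by simp
  qed
  have lam_UN: "lam (\<Union>i. U i) \<le> (\<Sum>i. lam (U i))" if op: "\<And>i. open (U i)" for U :: "nat \<Rightarrow> 'a set"
    unfolding lam_def[of "\<Union>i. U i"]
  proof (intro SUP_least, clarify)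
    fix K assume K: "closed K" "K \<subseteq> (\<Union>i. U i)"
    have "compact K" using K cpt by (metis compact_Int_closed inf_top.left_neutral)
    then obtain C where C: "finite C" "K \<subseteq> (\<Union>i\<in>C. U i)"
      using compactE_image[of K UNIV U] op K by (metis UNIV_I)
    obtain n where "C \<subseteq> {..<n}" using C(1) finite_nat_iff_bounded by auto
    then have "K \<subseteq> (\<Union>i<n. U i)" using C by blast
    then have "m K \<le> (\<Sum>i<n. lam (U i))" using fin_cover K op by blast
    also have "\<dots> \<le> (\<Sum>i. lam (U i))" by (intro sum_le_suminf) auto
    finally show "m K \<le> (\<Sum>i. lam (U i))" .
  qed
  have nu_UN: "nu (\<Union>i. A i) \<le> (\<Sum>i. nu (A i))" for A :: "nat \<Rightarrow> 'a set"
  proof (rule ennreal_le_epsilon)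
    fix e :: real assume e: "0 < e"
    have "\<exists>U. open U \<and> A i \<subseteq> U \<and> lam U \<le> nu (A i) + ennreal (e * (1/2) ^ Suc i)" for i
    proof -
      \<comment> \<open>In \<open>ennreal\<close>, adding a positive error gives a strictly larger
        value only if the original one is finite.\<close>
      have "nu (A i) < \<top>" using nu_le[of UNIV "A i"] lam_fin[of UNIV] by (auto intro: order.strict_trans1)
      then have "nu (A i) < nu (A i) + ennreal (e * (1/2) ^ Suc i)"
        using e by (simp add: ennreal_add_left_cancel_less)
      then show ?thesis unfolding nu_def[of "A i"] INF_less_iff by (auto intro: less_imp_le)
    qed
    then obtain U where U: "\<And>i. open (U i)" "\<And>i. A i \<subseteq> U i"
      "\<And>i. lam (U i) \<le> nu (A i) + ennreal (e * (1/2) ^ Suc i)" by metis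
    have "nu (\<Union>i. A i) \<le> lam (\<Union>i. U i)" using U by (intro nu_le) blast+
    also have "\<dots> \<le> (\<Sum>i. lam (U i))" using U lam_UN by blast
    also have "\<dots> \<le> (\<Sum>i. nu (A i) + ennreal (e * (1/2) ^ Suc i))"
      using U by (intro suminf_le) auto
    also have "\<dots> = (\<Sum>i. nu (A i)) + (\<Sum>i. ennreal (e * (1/2) ^ Suc i))"
      by (intro suminf_add[symmetric]) auto
    also have "(\<Sum>i. ennreal (e * (1/2) ^ Suc i)) = ennreal e"
      using sums_mult[OF power_half_series, of e] e by (intro suminf_ennreal_eq) auto
    finally show "nu (\<Union>i. A i) \<le> (\<Sum>i. nu (A i)) + ennreal e" .
  qed
  have nu_empty: "nu {} = 0"
    using nu_open[of "{}"] lam_le_m[of "{}"] empty by simp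
  have outer: "outer_measure_space UNIV nu"
    unfolding outer_measure_space_def positive_def increasing_def countably_subadditive_def
    using nu_empty nu_mono nu_UN by auto
  \<comment> \<open>The second \<open>UNIV\<close> is the full power set: \<open>nu\<close> is an
    outer measure on all subsets, and its measurable sets are cut out from there.\<close>
  interpret sigma_algebra "UNIV :: 'a set" UNIV by (metis Pow_UNIV sigma_algebra_Pow)
  let ?L = "lambda_system UNIV UNIV nu"
  have ms: "measure_space UNIV ?L nu"
    by (rule caratheodory_lemma[OF outer])
  have open_L: "V \<in> ?L" if V: "open V" for V
    unfolding lambda_system_eq
  proof (clarsimp, intro antisym)
    fix X
    have "nu (X \<inter> V \<union> (X - V)) \<le> nu (X \<inter> V) + nu (X - V)"
    proof -
      have "nu (\<Union>i. binaryset (X \<inter> V) (X - V) i) \<le> (\<Sum>i. nu (binaryset (X \<inter> V) (X - V) i))"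
        by (rule nu_UN)
      then show ?thesis using suminf_binaryset_eq[of nu "X \<inter> V" "X - V"] nu_empty
        by (simp add: UN_binaryset_eq)
    qed
    then show "nu X \<le> nu (X \<inter> V) + nu (X - V)" by (simp add: Int_Diff_Un)
    show "nu (X \<inter> V) + nu (X - V) \<le> nu X"
      unfolding nu_def[of X]
    proof (intro INF_greatest, clarify)
      fix U assume U: "open U" "X \<subseteq> U"
      \<comment> \<open>Closed subsets of \<open>U - K\<close> are disjoint from \<open>K\<close>,
        so \<open>m\<close> adds their values to \<open>m K\<close>, and the unions are closed
        subsets of \<open>U\<close>. As \<open>U - K\<close> is open and contains
        \<open>X - V\<close>, a supremum over \<open>K\<close> then yields the Caratheodory
        inequality.\<close>
      have *: "m K + lam (U - K) \<le> lam U" if K: "closed K" "K \<subseteq> U \<inter> V" for K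
      proof -
        have "m K + m K' \<le> lam U" if "closed K'" "K' \<subseteq> U - K" for K'
        proof -
          have "m K + m K' = m (K \<union> K')" using that(2) by (intro add[symmetric]) auto
          also have "\<dots> \<le> lam U"
            using that K by (intro m_le_lam) auto
          finally show ?thesis .
        qed
        then show ?thesis
          unfolding lam_def[of "U - K"]
          by (subst ennreal_SUP_add_right) (auto intro!: SUP_least)
      qed
      have "m K + nu (X - V) \<le> lam U" if "closed K" "K \<subseteq> U \<inter> V" for K
      proof -
        have "nu (X - V) \<le> lam (U - K)"
          using that U by (intro nu_le) auto
        then show ?thesis using *[OF that] by (meson add_left_mono order_trans)
      qed
      then have "lam (U \<inter> V) + nu (X - V) \<le> lam U"
        unfolding lam_def[of "U \<inter> V"]
        by (subst ennreal_SUP_add_left[symmetric]) (auto intro!: SUP_least)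
      moreover have "nu (X \<inter> V) \<le> lam (U \<inter> V)" using U V by (intro nu_le) auto
      ultimately show "nu (X \<inter> V) + nu (X - V) \<le> lam U"
        by (meson add_right_mono order_trans)
    qed
  qed
  have borel_L: "sets borel \<subseteq> ?L"
  proof -
    have "sigma_sets UNIV (Collect open) \<subseteq> ?L"
      using ms open_L by (intro sigma_algebra.sigma_sets_subset) (auto simp: measure_space_def)
    then show ?thesis by (simp add: borel_def)
  qed
  define N where "N = measure_of UNIV (sets borel) nu"
  have em: "emeasure N A = nu A" if "A \<in> sets borel" for A
    unfolding N_def
  proof (rule emeasure_measure_of_sigma)
    show "sigma_algebra UNIV (sets borel :: 'a set set)"
      by (metis sets.sigma_algebra_axioms space_borel)
    show "positive (sets borel) nu" by (simp add: positive_def nu_empty)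
    show "countably_additive (sets borel) nu"
      using ms borel_L unfolding measure_space_def countably_additive_def by blast
  qed fact
  show ?thesis
  proof
    show "sets N = sets borel" unfolding N_def by (metis sets.sets_measure_of_eq space_borel)
    \<comment> \<open>The whole space is both open and closed, so the inner regularisation loses
      nothing there.\<close>
    show "emeasure N UNIV = m UNIV"
      using em[of UNIV] nu_open[of UNIV] lam_le_m[of UNIV] m_le_lam[of UNIV UNIV] by simp
    show "emeasure N U \<le> m U" if "open U" for U
      using that em[of U] nu_open[of U] lam_le_m[of U] by simp
  qed
qed

section \<open>Generalised limits of bounded sequences\<close>

text \<open>One filter has to serve all bounded sequences at once, because the limit of the
  empirical averages is needed for every bounded function, indicators included; a diagonal
  subsequence handles only countably many.\<close>

lemma filter_bounded_seqs_converge: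
  obtains G :: "nat filter" where "G \<noteq> bot" "G \<le> sequentially"
    "\<forall>s :: nat \<Rightarrow> real. bounded (range s) \<longrightarrow> (\<exists>l. (s \<longlongrightarrow> l) G)"
proof -
  \<comment> \<open>Tychonoff: the evaluation maps \<open>q n\<close> lie in a product of compact sets, indexed by all sequences.\<close>
  define q :: "nat \<Rightarrow> (nat \<Rightarrow> real) \<Rightarrow> real" where "q n s = (if bounded (range s) then s n else 0)" for n s
  define B where "B s = closure (range (\<lambda>n. q n s))" for s
  have B: "compact (B s)" for s
  proof -
    have "bounded (range (\<lambda>n. q n s))"
      by (cases "bounded (range s)") (auto simp: q_def)
    then show ?thesis by (simp add: B_def)
  qed
  have "compactin (product_topology (\<lambda>_. euclidean) UNIV) (PiE UNIV B)"
    using B by (simp add: compactin_PiE)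
  then have cpt: "compact (PiE UNIV B)" by (simp add: euclidean_product_topology)
  have ev: "eventually (\<lambda>y. y \<in> PiE UNIV B) (filtermap q sequentially)"
    by (auto simp: eventually_filtermap B_def intro!: always_eventually closure_subset[THEN subsetD])
  have "filtermap q sequentially \<noteq> bot" by (simp add: filtermap_bot_iff)
  then obtain y where y: "inf (nhds y) (filtermap q sequentially) \<noteq> bot"
    using cpt[unfolded compact_filter] ev by blast
  \<comment> \<open>Near the cluster point \<open>y\<close>, finitely many coordinates of
    \<open>q n\<close> at a time are close to those of \<open>y\<close>. Pulling these
    neighbourhoods back to the indices turns clustering into convergence of every
    coordinate.\<close>
  define G where "G = inf (filtercomap q (nhds y)) sequentially"
  have "G \<noteq> bot"
  proof
    assume "G = bot"
    then have "eventually (\<lambda>_. False) G" by simp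
    then obtain P Q where PQ: "eventually P (filtercomap q (nhds y))" "eventually Q sequentially"
      "\<And>n. P n \<Longrightarrow> Q n \<Longrightarrow> False"
      unfolding G_def eventually_inf by auto
    from PQ(1) obtain P' where P': "eventually P' (nhds y)" "\<And>n. P' (q n) \<Longrightarrow> P n"
      unfolding eventually_filtercomap by auto
    have "eventually (\<lambda>z. \<not> P' z) (filtermap q sequentially)"
      unfolding eventually_filtermap using PQ(2) by eventually_elim (use PQ(3) P'(2) in blast)
    then have "eventually (\<lambda>_. False) (inf (nhds y) (filtermap q sequentially))"
      using P'(1) unfolding eventually_inf by blast
    then show False using y by (simp add: trivial_limit_def)
  qed
  moreover have "G \<le> sequentially" by (simp add: G_def)
  moreover have "\<exists>l. (s \<longlongrightarrow> l) G" if s: "bounded (range s)" for s :: "nat \<Rightarrow> real"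
  proof -
    have "filterlim q (nhds y) G"
      unfolding G_def by (rule filterlim_mono[OF filterlim_filtercomap order_refl inf_le1])
    then have "((\<lambda>n. q n s) \<longlongrightarrow> y s) G"
      using continuous_on_tendsto_compose[of UNIV "\<lambda>z. z s" q y G] by simp
    then show ?thesis using s by (auto simp: q_def)
  qed
  ultimately show ?thesis using that by blast
qed

section \<open>Continuous functions and the measures they determine\<close>

lemma bounded_range_iff_abs: "bounded (range u) \<longleftrightarrow> (\<exists>B. \<forall>x. \<bar>u x :: real\<bar> \<le> B)"
  by (auto simp: bounded_iff)

lemma borel_measurable_continuous_sets_borel:
  fixes u :: "'a::topological_space \<Rightarrow> real"
  assumes "sets M = sets borel" "continuous_on UNIV u"
  shows "u \<in> borel_measurable M"
  using borel_measurable_continuous_onI[OF assms(2)] assms(1) by (simp cong: measurable_cong_sets)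

lemma integrable_bounded_continuous:
  fixes u :: "'a::topological_space \<Rightarrow> real"
  assumes "finite_measure M" "sets M = sets borel" "continuous_on UNIV u" "bounded (range u)"
  shows "integrable M u"
proof -
  obtain B where "\<And>x. \<bar>u x\<bar> \<le> B" using assms(4) unfolding bounded_range_iff_abs by blast
  then show ?thesis
    using borel_measurable_continuous_sets_borel[OF assms(2,3)]
    by (intro finite_measure.integrable_const_bound[OF assms(1), of _ B]) auto
qed

text \<open>Junk value: \<open>infdist x {} = 0\<close>, so \<open>cutoff {} n\<close> is constantly 1, not 0.\<close>

definition cutoff :: "'a::metric_space set \<Rightarrow> nat \<Rightarrow> 'a \<Rightarrow> real" where
  "cutoff E n x = max 0 (min 1 (2 - real n * infdist x E))"

lemma continuous_cutoff: "continuous_on UNIV (cutoff E n)"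
  unfolding cutoff_def by (intro continuous_intros)

lemma cutoff_bounds: "0 \<le> cutoff E n x" "cutoff E n x \<le> 1"
  by (auto simp: cutoff_def)

text \<open>A point outside a closed set has positive distance from it, so the cutoffs converge
  pointwise to the indicator, and dominated convergence applies.\<close>

lemma integral_cutoff_tendsto:
  assumes "finite_measure M" "sets M = sets borel" "closed E" "E \<noteq> {}"
  shows "(\<lambda>n. \<integral>x. cutoff E n x \<partial>M) \<longlonglongrightarrow> measure M E"
proof -
  interpret finite_measure M by fact
  have sp: "space M = UNIV" using sets_eq_imp_space_eq[OF assms(2)] by simp
  have E: "E \<in> sets M" using assms by simp
  have meas: "cutoff E n \<in> borel_measurable M" for n
    using assms(2) continuous_cutoff by (rule borel_measurable_continuous_sets_borel)
  have lim: "(\<lambda>n. cutoff E n x) \<longlonglongrightarrow> indicator E x" for x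
  proof (cases "x \<in> E")
    case True
    then show ?thesis by (simp add: cutoff_def)
  next
    case False
    then have pos: "infdist x E > 0"
      using assms infdist_nonneg[of x E] in_closed_iff_infdist_zero[of E x] by force
    then obtain n0 where n0: "2 / infdist x E < real n0" using reals_Archimedean2 by blast
    have "cutoff E n x = 0" if "n \<ge> n0" for n
    proof -
      have "2 \<le> real n0 * infdist x E" using n0 pos by (simp add: field_simps)
      also have "\<dots> \<le> real n * infdist x E" using that pos by (simp add: mult_right_mono)
      finally show ?thesis by (simp add: cutoff_def)
    qed
    then have "eventually (\<lambda>n. cutoff E n x = 0) sequentially" by (auto simp: eventually_sequentially)
    then show ?thesis using False by (simp add: tendsto_eventually)
  qed
  have "(\<lambda>n. \<integral>x. cutoff E n x \<partial>M) \<longlonglongrightarrow> (\<integral>x. indicator E x \<partial>M)"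
    by (rule integral_dominated_convergence[where w="\<lambda>_. 1"])
      (use meas E lim cutoff_bounds[of E] in \<open>auto intro!: borel_measurable_indicator\<close>)
  then show ?thesis using E by simp
qed

text \<open>Cutoffs recover the measure of closed sets, which form an intersection-stable generator
  of the Borel sets.\<close>

lemma measure_eqI_continuous:
  fixes M N :: "'a::metric_space measure"
  assumes "prob_space M" "prob_space N" and sM: "sets M = sets borel" and sN: "sets N = sets borel"
    and eq: "\<And>u :: 'a \<Rightarrow> real. \<lbrakk>continuous_on UNIV u; \<And>x. 0 \<le> u x; \<And>x. u x \<le> 1\<rbrakk> \<Longrightarrow>
          integral\<^sup>L M u = integral\<^sup>L N u"
  shows "M = N"
proof -
  interpret M: prob_space M by fact
  interpret N: prob_space N by fact
  have "emeasure M E = emeasure N E" if "closed E" for E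
  proof (cases "E = {}")
    case False
    have "(\<lambda>n. \<integral>x. cutoff E n x \<partial>M) \<longlonglongrightarrow> measure M E"
      using that False sM by (intro integral_cutoff_tendsto) unfold_locales
    moreover have "(\<lambda>n. \<integral>x. cutoff E n x \<partial>N) \<longlonglongrightarrow> measure N E"
      using that False sN by (intro integral_cutoff_tendsto) unfold_locales
    moreover have "(\<integral>x. cutoff E n x \<partial>M) = (\<integral>x. cutoff E n x \<partial>N)" for n
      using continuous_cutoff cutoff_bounds by (intro eq)
    ultimately have "measure M E = measure N E" using LIMSEQ_unique by fastforce
    then show ?thesis by (simp add: M.emeasure_eq_measure N.emeasure_eq_measure)
  qed simp
  then show ?thesis
    by (intro measure_eqI_generator_eq[of "Collect closed" UNIV M N "\<lambda>_. UNIV"])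
      (auto simp: Int_stable_def sM sN borel_eq_closed)
qed

section \<open>Riesz representation on a compact space\<close>

text \<open>A discrete layer-cake formula: the sum counts the integers from 1 to \<open>n\<close>
  below \<open>t\<close>. It never exceeds \<open>n\<close>, hence the \<open>min\<close> in the
  lower bound.\<close>

lemma layer_sum_bounds:
  fixes t :: real
  assumes "0 \<le> t"
  shows "(\<Sum>i<n. of_bool (real (Suc i) < t)) \<le> t"
    and "min t (real n + 1) - 1 \<le> (\<Sum>i<n. of_bool (real (Suc i) < t))"
proof -
  have "(\<Sum>i<n. of_bool (real (Suc i) < t)) \<le> min t (real n) \<and>
        min t (real n + 1) - 1 \<le> (\<Sum>i<n. of_bool (real (Suc i) < t))"
    using assms by (induction n) auto
  then show "(\<Sum>i<n. of_bool (real (Suc i) < t)) \<le> t"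
    "min t (real n + 1) - 1 \<le> (\<Sum>i<n. of_bool (real (Suc i) < t))" by auto
qed

text \<open>The content of a set is \<open>L\<close> of its indicator, which is why \<open>L\<close>
  acts on all bounded functions. Layers of open sets give one inequality for functions with values
  between 0 and 1.\<close>

lemma Riesz_representation_compact:
  fixes L :: "('a::metric_space \<Rightarrow> real) \<Rightarrow> real"
  assumes cpt: "compact (UNIV :: 'a set)"
    and add: "\<And>u v. bounded (range u) \<Longrightarrow> bounded (range v) \<Longrightarrow> L (\<lambda>x. u x + v x) = L u + L v"
    and scale: "\<And>c u. bounded (range u) \<Longrightarrow> L (\<lambda>x. c * u x) = c * L u"
    and pos: "\<And>u. bounded (range u) \<Longrightarrow> (\<And>x. 0 \<le> u x) \<Longrightarrow> 0 \<le> L u"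
    and one: "L (\<lambda>_. 1) = 1"
  obtains N where "prob_space N" "sets N = sets borel"
    "\<forall>u. continuous_on UNIV u \<longrightarrow> integral\<^sup>L N u = L u"
proof -
  note bd = bounded_range_iff_abs
  have bd_add: "bounded (range (\<lambda>x. u x + v x))" if "bounded (range u)" "bounded (range v)" for u v :: "'a \<Rightarrow> real"
    using that unfolding bd by (meson abs_triangle_ineq add_mono order_trans)
  have bd_scale: "bounded (range (\<lambda>x. c * u x))" if "bounded (range u)" for c and u :: "'a \<Rightarrow> real"
    using that unfolding bd abs_mult by (meson abs_ge_zero mult_left_mono)
  have bd_const: "bounded (range (\<lambda>_::'a. c))" for c :: real unfolding bd by auto
  have bd_ind: "bounded (range (indicator A :: 'a \<Rightarrow> real))" for A
    unfolding bd by (intro exI[of _ 1]) (auto simp: indicator_def)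
  have const: "L (\<lambda>_. c) = c" for c using scale[OF bd_const, of c 1] one by simp
  have mono: "L u \<le> L v" if "bounded (range u)" "bounded (range v)" "\<And>x. u x \<le> v x" for u v
  proof -
    have b: "bounded (range (\<lambda>x. v x + (- 1) * u x))" using that by (intro bd_add bd_scale)
    have "0 \<le> L (\<lambda>x. v x + (- 1) * u x)" using that b by (intro pos) auto
    then show ?thesis using add[OF that(2) bd_scale[OF that(1), of "- 1"]] scale[OF that(1), of "-1"] by simp
  qed
  have L_sum: "L (\<lambda>x. \<Sum>i<n. u i x) = (\<Sum>i<n. L (u i)) \<and> bounded (range (\<lambda>x. \<Sum>i<n. u i x))"
    if "\<And>i. bounded (range (u i))" for u and n :: nat
    by (induction n) (use that add bd_add in \<open>auto simp: const bd_const\<close>)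
  obtain N where N: "sets N = sets borel" "emeasure N UNIV = ennreal (L (indicator UNIV))"
    "\<And>U. open U \<Longrightarrow> emeasure N U \<le> ennreal (L (indicator U))"
  proof (rule Borel_measure_of_content[of "\<lambda>A. ennreal (L (indicator A))"])
    show "ennreal (L (indicator A)) \<le> ennreal (L (indicator B))" if "A \<subseteq> B" for A B :: "'a set"
      using that by (intro ennreal_leI mono bd_ind) (auto simp: indicator_def)
    show "ennreal (L (indicator (A \<union> B))) = ennreal (L (indicator A)) + ennreal (L (indicator B))"
      if "A \<inter> B = {}" for A B :: "'a set"
    proof -
      have eq: "(indicator (A \<union> B) :: 'a \<Rightarrow> real) = (\<lambda>x. indicator A x + indicator B x)"
        using that by (auto simp: indicator_def fun_eq_iff)
      have "0 \<le> L (indicator A)" "0 \<le> L (indicator B)" by (intro pos bd_ind; simp)+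
      then show ?thesis unfolding eq by (subst add[OF bd_ind bd_ind]) (simp add: ennreal_plus)
    qed
  qed (use cpt const[of 0] in \<open>auto simp: indicator_def[abs_def]\<close>)
  have sp: "space N = UNIV" using sets_eq_imp_space_eq[OF N(1)] by simp
  have "emeasure N (space N) = 1" using N(2) one by (simp add: sp indicator_def[abs_def])
  then interpret prob_space N by (rule prob_spaceI)
  have int: "integrable N u" if "continuous_on UNIV u" "bounded (range u)" for u :: "'a \<Rightarrow> real"
    using that N(1) by (intro integrable_bounded_continuous) unfold_locales
  have le: "integral\<^sup>L N u \<le> L u" if u: "continuous_on UNIV u" "\<And>x. 0 \<le> u x" "\<And>x. u x \<le> 1" for u
  proof (rule field_le_epsilon)
    fix e :: real assume "0 < e"
    then obtain n where n: "inverse (real (Suc n)) < e" using reals_Archimedean by blast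
    define k where "k = Suc n"
    have k: "0 < k" "1 / real k < e" using n by (auto simp: k_def field_simps)
    \<comment> \<open>Strict superlevel sets of \<open>u\<close> are open, and on open sets
      \<open>N\<close> lies below the content. Their indicators add up to \<open>k * u\<close>
      within an error of 1, which becomes \<open>1 / k\<close> after division.\<close>
    define U where "U i = {x. real (Suc i) < real k * u x}" for i
    define s where "s x = (\<Sum>i<k. indicator (U i) x :: real)" for x
    have bdu: "bounded (range u)" unfolding bd using u by (intro exI[of _ 1]) auto
    have op: "open (U i)" for i
      unfolding U_def using u(1) by (intro open_Collect_less continuous_intros) auto
    have s_eq: "s x = (\<Sum>i<k. of_bool (real (Suc i) < real k * u x))" for x
      by (simp add: s_def U_def indicator_def of_bool_def)
    have s: "s x \<le> real k * u x" "real k * u x - 1 \<le> s x" for x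
    proof -
      have t: "0 \<le> real k * u x" "real k * u x \<le> real k" using u k by (auto simp: mult_left_le)
      show "s x \<le> real k * u x" using layer_sum_bounds(1)[OF t(1), of k] by (simp add: s_eq)
      show "real k * u x - 1 \<le> s x" using layer_sum_bounds(2)[OF t(1), of k] t(2) by (simp add: s_eq)
    qed
    have Uint: "integrable N (indicator (U i) :: 'a \<Rightarrow> real)" for i
      using op[of i] N(1) by (intro integrable_real_indicator) (auto simp: emeasure_eq_measure)
    have sint: "integrable N s" unfolding s_def using Uint by auto
    have "real k * integral\<^sup>L N u - 1 = (\<integral>x. real k * u x - 1 \<partial>N)"
      using int[OF u(1) bdu] by (simp add: prob_space)
    also have "\<dots> \<le> integral\<^sup>L N s"
      using s int[OF u(1) bdu] sint by (intro integral_mono) auto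
    also have "\<dots> = (\<Sum>i<k. measure N (U i))"
      unfolding s_def using Uint by (subst Bochner_Integration.integral_sum) (auto simp: sp)
    also have "\<dots> \<le> (\<Sum>i<k. L (indicator (U i)))"
    proof (intro sum_mono)
      fix i
      have "0 \<le> L (indicator (U i))" by (intro pos bd_ind) simp
      then show "measure N (U i) \<le> L (indicator (U i))"
        using N(3)[OF op[of i]] by (simp add: emeasure_eq_measure)
    qed
    also have "\<dots> = L s" unfolding s_def using L_sum[of "\<lambda>i. indicator (U i)" k] bd_ind by simp
    also have "\<dots> \<le> L (\<lambda>x. real k * u x)"
      using s L_sum[of "\<lambda>i. indicator (U i)" k] bd_ind bd_scale[OF bdu]
      by (intro mono) (auto simp: s_def)
    also have "\<dots> = real k * L u" by (rule scale[OF bdu])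
    finally have "integral\<^sup>L N u \<le> L u + 1 / real k" using k by (simp add: field_simps)
    then show "integral\<^sup>L N u \<le> L u + e" using k by simp
  qed
  have eq: "integral\<^sup>L N u = L u" if u: "continuous_on UNIV u" "\<And>x. 0 \<le> u x" "\<And>x. u x \<le> 1" for u
  proof (rule antisym)
    show "integral\<^sup>L N u \<le> L u" using u by (rule le)
    have bdu: "bounded (range u)" unfolding bd using u by (intro exI[of _ 1]) auto
    \<comment> \<open>Applying \<open>le\<close> to \<open>1 - u\<close> reverses the inequality,
      because \<open>N\<close> and \<open>L\<close> both give the constant 1 the value 1.\<close>
    have "integral\<^sup>L N (\<lambda>x. 1 + (- 1) * u x) \<le> L (\<lambda>x. 1 + (- 1) * u x)"
      using u by (intro le continuous_intros) auto
    also have "\<dots> = 1 - L u" using add[OF bd_const[of 1] bd_scale[OF bdu, of "-1"]] scale[OF bdu, of "-1"] one by simp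
    finally show "L u \<le> integral\<^sup>L N u" using int[OF u(1) bdu] by (simp add: prob_space)
  qed
  show ?thesis
  proof (rule that)
    show "prob_space N" by unfold_locales
    show "sets N = sets borel" by fact
    show "\<forall>u. continuous_on UNIV u \<longrightarrow> integral\<^sup>L N u = L u"
    proof (intro allI impI)
      fix u :: "'a \<Rightarrow> real" assume u: "continuous_on UNIV u"
      have bdu: "bounded (range u)" using compact_continuous_image[OF u cpt] compact_imp_bounded by blast
      then obtain B0 where "\<And>x. \<bar>u x\<bar> \<le> B0" unfolding bd by blast
      then obtain B where B: "\<And>x. \<bar>u x\<bar> \<le> B" "0 < B"
        by (intro that[of "max B0 1"]) (auto simp: le_max_iff_disj)
      \<comment> \<open>With this scale \<open>1/2 + c * u\<close> takes values between 0 and 1, so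
        the special case covers it.\<close>
      define c where "c = 1 / (2 * B)"
      have c: "c > 0" "c * B = 1/2" using B by (auto simp: c_def)
      have "L (\<lambda>x. 1/2 + c * u x) = 1/2 + c * L u"
        using add[OF bd_const[of "1/2"] bd_scale[OF bdu, of c]] scale[OF bdu, of c] const by simp
      moreover have "integral\<^sup>L N (\<lambda>x. 1/2 + c * u x) = 1/2 + c * integral\<^sup>L N u"
        using int[OF u bdu] by (simp add: prob_space)
      moreover have "integral\<^sup>L N (\<lambda>x. 1/2 + c * u x) = L (\<lambda>x. 1/2 + c * u x)"
      proof (rule eq)
        show "continuous_on UNIV (\<lambda>x. 1/2 + c * u x)" using u by (intro continuous_intros)
        fix x
        have "\<bar>c * u x\<bar> \<le> 1/2" using mult_left_mono[OF B(1)[of x], of c] c by (simp add: abs_mult)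
        then show "0 \<le> 1/2 + c * u x" "1/2 + c * u x \<le> 1" by linarith+
      qed
      ultimately show "integral\<^sup>L N u = L u" using c by simp
    qed
  qed
qed

section \<open>Unique ergodicity and Birkhoff sums\<close>

text \<open>Upper bounds suffice, since subadditivity bounds a cocycle by Birkhoff sums only from
  above. Orbit segments of growing length that violate the bound would produce an invariant measure
  whose integral of \<open>h\<close> is too large.\<close>

lemma uniquely_ergodic_uniform_upper_bound:
  fixes R :: "'a::metric_space \<Rightarrow> 'a" and h :: "'a \<Rightarrow> real"
  assumes cpt: "compact (UNIV :: 'a set)" and R: "continuous_on UNIV R"
    and ue: "uniquely_ergodic R \<mu>" and h: "continuous_on UNIV h" and e: "e > 0"
  obtains K where "\<forall>n\<ge>K. \<forall>x. (\<Sum>k<n. h ((R ^^ k) x)) \<le> real n * (integral\<^sup>L \<mu> h + e)"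
proof (rule ccontr)
  assume "\<not> thesis"
  then have "\<forall>K. \<exists>n\<ge>K. \<exists>x. real n * (integral\<^sup>L \<mu> h + e) < (\<Sum>k<n. h ((R ^^ k) x))"
    using that by (meson not_le)
  then obtain p x where p: "\<And>K. p K \<ge> K"
    and big: "\<And>K. real (p K) * (integral\<^sup>L \<mu> h + e) < (\<Sum>k<p K. h ((R ^^ k) (x K)))"
    by metis
  \<comment> \<open>For \<open>p K = 0\<close> both sides of \<open>big\<close> are 0, which its
    strictness forbids; the averages below thus never divide by 0.\<close>
  have p0: "p K > 0" for K using big[of K] by (cases "p K") auto
  obtain G :: "nat filter" where G: "G \<noteq> bot" "G \<le> sequentially"
    "\<forall>s :: nat \<Rightarrow> real. bounded (range s) \<longrightarrow> (\<exists>l. (s \<longlongrightarrow> l) G)"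
    by (rule filter_bounded_seqs_converge)
  define A where "A K u = (\<Sum>k<p K. u ((R ^^ k) (x K))) / real (p K)" for K and u :: "'a \<Rightarrow> real"
  define L where "L u = Lim G (\<lambda>K. A K u)" for u
  have A_bound: "\<bar>A K u\<bar> \<le> B" if "\<And>x. \<bar>u x\<bar> \<le> B" for K u B
  proof -
    have "\<bar>\<Sum>k<p K. u ((R ^^ k) (x K))\<bar> \<le> (\<Sum>k<p K. B)"
      using that by (intro order_trans[OF sum_abs] sum_mono)
    then show ?thesis using p0[of K] by (simp add: A_def field_simps)
  qed
  have L: "((\<lambda>K. A K u) \<longlongrightarrow> L u) G" if "bounded (range u)" for u
  proof -
    have "bounded (range (\<lambda>K. A K u))"
      using that A_bound unfolding bounded_range_iff_abs by metis
    then obtain l where "((\<lambda>K. A K u) \<longlongrightarrow> l) G" using G(3) by blast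
    then show ?thesis using tendsto_Lim[OF G(1)] by (auto simp: L_def)
  qed
  have L_eq: "L u = l" if "((\<lambda>K. A K u) \<longlongrightarrow> l) G" for u l
    using tendsto_Lim[OF G(1) that] by (simp add: L_def)
  obtain N where N: "prob_space N" "sets N = sets borel"
    "\<forall>u. continuous_on UNIV u \<longrightarrow> integral\<^sup>L N u = L u"
  proof (rule Riesz_representation_compact[OF cpt, of L])
    fix u v :: "'a \<Rightarrow> real" assume "bounded (range u)" "bounded (range v)"
    then have "((\<lambda>K. A K u + A K v) \<longlongrightarrow> L u + L v) G" by (intro tendsto_add L)
    moreover have "A K u + A K v = A K (\<lambda>x. u x + v x)" for K
      by (simp add: A_def sum.distrib add_divide_distrib)
    ultimately show "L (\<lambda>x. u x + v x) = L u + L v" by (intro L_eq) simp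
  next
    fix c and u :: "'a \<Rightarrow> real" assume "bounded (range u)"
    then have "((\<lambda>K. c * A K u) \<longlongrightarrow> c * L u) G" by (intro tendsto_mult_left L)
    moreover have "c * A K u = A K (\<lambda>x. c * u x)" for K
      by (simp add: A_def sum_distrib_left)
    ultimately show "L (\<lambda>x. c * u x) = c * L u" by (intro L_eq) simp
  next
    fix u :: "'a \<Rightarrow> real" assume u: "bounded (range u)" "\<And>x. 0 \<le> u x"
    have "0 \<le> A K u" for K using u(2) by (simp add: A_def sum_nonneg)
    then show "0 \<le> L u" using tendsto_lowerbound[OF L[OF u(1)] _ G(1), of 0] by simp
  next
    have "A K (\<lambda>_. 1) = 1" for K using p0[of K] by (simp add: A_def)
    then show "L (\<lambda>_. 1) = 1" by (intro L_eq) simp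
  qed
  have bd: "bounded (range u)" if "continuous_on UNIV u" for u :: "'a \<Rightarrow> real"
    using compact_continuous_image[OF that cpt] compact_imp_bounded by blast
  have inv: "L (\<lambda>y. u (R y)) = L u" if u: "continuous_on UNIV u" for u
  proof (rule L_eq)
    obtain B where B: "\<And>x. \<bar>u x\<bar> \<le> B" using bd[OF u] unfolding bounded_range_iff_abs by blast
    \<comment> \<open>Composing with \<open>R\<close> shifts the orbit sum by one step, so only its
      two end terms survive; the length \<open>p K\<close> is at least \<open>K\<close>.\<close>
    have "norm (A K (\<lambda>y. u (R y)) - A K u) \<le> 2 * B * inverse (real K)" if "K \<ge> 1" for K
    proof -
      have "A K (\<lambda>y. u (R y)) - A K u = (u ((R ^^ p K) (x K)) - u (x K)) / real (p K)"
        using sum_lessThan_telescope[of "\<lambda>k. u ((R ^^ k) (x K))" "p K"]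
        by (simp add: A_def diff_divide_distrib[symmetric] sum_subtractf[symmetric])
      then have "norm (A K (\<lambda>y. u (R y)) - A K u) = \<bar>u ((R ^^ p K) (x K)) - u (x K)\<bar> / real (p K)"
        by simp
      also have "\<dots> \<le> (2 * B) / real K"
        using that p[of K] B[of "(R ^^ p K) (x K)"] B[of "x K"] by (intro frac_le) auto
      finally show ?thesis by (simp add: field_simps)
    qed
    then have "eventually (\<lambda>K. norm (A K (\<lambda>y. u (R y)) - A K u) \<le> 2 * B * inverse (real K)) sequentially"
      unfolding eventually_sequentially by blast
    moreover have "(\<lambda>K. 2 * B * inverse (real K)) \<longlonglongrightarrow> 0"
      by (rule tendsto_mult_right_zero[OF lim_inverse_n])
    ultimately have "((\<lambda>K. A K (\<lambda>y. u (R y)) - A K u) \<longlongrightarrow> 0) sequentially"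
      by (rule Lim_null_comparison)
    then have "((\<lambda>K. A K (\<lambda>y. u (R y)) - A K u) \<longlongrightarrow> 0) G"
      using G(2) tendsto_mono by blast
    from tendsto_add[OF this L[OF bd[OF u]]] show "((\<lambda>K. A K (\<lambda>y. u (R y))) \<longlongrightarrow> L u) G" by simp
  qed
  have Rm: "R \<in> measurable N borel"
    using borel_measurable_continuous_onI[OF R] N(2) by (simp cong: measurable_cong_sets)
  have "distr N borel R = N"
  proof (rule measure_eqI_continuous)
    show "prob_space (distr N borel R)" using N(1) Rm by (rule prob_space.prob_space_distr)
    fix u :: "'a \<Rightarrow> real" assume u: "continuous_on UNIV u"
    have "integral\<^sup>L (distr N borel R) u = integral\<^sup>L N (\<lambda>y. u (R y))"
      using Rm borel_measurable_continuous_onI[OF u] by (rule integral_distr)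
    also have "\<dots> = L (\<lambda>y. u (R y))"
      using continuous_on_compose2[OF u R] by (intro N(3)[rule_format]) simp
    finally show "integral\<^sup>L (distr N borel R) u = integral\<^sup>L N u"
      using inv[OF u] N(3)[rule_format, OF u] by simp
  qed (use N in auto)
  then have "N = \<mu>" using ue N unfolding uniquely_ergodic_def invariant_prob_def by blast
  then have "L h = integral\<^sup>L \<mu> h" using N(3)[rule_format, OF h] by simp
  moreover have "integral\<^sup>L \<mu> h + e \<le> A K h" for K
    using big[of K] p0[of K] by (simp add: A_def field_simps)
  then have "integral\<^sup>L \<mu> h + e \<le> L h"
    by (intro tendsto_lowerbound[OF L[OF bd[OF h]] _ G(1)]) simp
  ultimately show False using e by simp
qed

section \<open>Cutting orbits into blocks\<close>

lemma subadditive_cocycle_le_linear: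
  assumes sub: "subadditive_cocycle R g" and C: "\<And>x. g 1 x \<le> C" and n: "n \<ge> 1"
  shows "g n x \<le> real n * C"
  using n
proof (induction n rule: dec_induct)
  case base
  then show ?case using C by simp
next
  case (step n)
  have "g (n + 1) x \<le> g n x + g 1 ((R ^^ n) x)"
    using step sub unfolding subadditive_cocycle_def by blast
  also have "\<dots> \<le> real n * C + C" using step C by (intro add_mono) auto
  finally show ?case by (simp add: algebra_simps)
qed

text \<open>An orbit segment is split into a head of length \<open>j\<close>, \<open>q\<close>
  blocks of length \<open>N\<close>, and a tail of length \<open>r\<close>. Head and tail cost at
  most \<open>C\<close> per step. The tail is nonempty because the cocycle inequality covers
  positive lengths only.\<close>

lemma subadditive_cocycle_le_blocks:
  assumes sub: "subadditive_cocycle R g" and C: "\<And>x. g 1 x \<le> C" and N: "N \<ge> 1" and r: "r \<ge> 1"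
  shows "g (j + q * N + r) x \<le> (\<Sum>i<q. g N ((R ^^ (j + i * N)) x)) + real (j + r) * C"
proof -
  have sub': "g (n + m) x \<le> g n x + g m ((R ^^ n) x)" if "n \<ge> 1" "m \<ge> 1" for n m x
    using sub that unfolding subadditive_cocycle_def by blast
  note lin = subadditive_cocycle_le_linear[of R g C, OF sub C]
  have blocks: "g (q * N + r) x \<le> (\<Sum>i<q. g N ((R ^^ (i * N)) x)) + real r * C" for q x
  proof (induction q arbitrary: x)
    case 0
    then show ?case using lin[OF r] by simp
  next
    case (Suc q)
    have "g (N + (q * N + r)) x \<le> g N x + g (q * N + r) ((R ^^ N) x)"
      using N r by (intro sub') auto
    also have "\<dots> \<le> g N x + ((\<Sum>i<q. g N ((R ^^ (i * N)) ((R ^^ N) x))) + real r * C)"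
      using Suc.IH by (intro add_left_mono)
    also have "\<dots> = (\<Sum>i<Suc q. g N ((R ^^ (i * N)) x)) + real r * C"
      by (subst sum.lessThan_Suc_shift)
        (simp add: funpow_add[THEN fun_cong, simplified, symmetric] add.commute)
    finally show ?case by (simp add: add.assoc)
  qed
  show ?thesis
  \<comment> \<open>An empty head cannot be split off by the cocycle inequality, so it is treated
    separately.\<close>
  proof (cases "j = 0")
    case True
    then show ?thesis using blocks by simp
  next
    case False
    have "g (j + (q * N + r)) x \<le> g j x + g (q * N + r) ((R ^^ j) x)"
      using False r by (intro sub') auto
    also have "\<dots> \<le> real j * C + ((\<Sum>i<q. g N ((R ^^ (i * N)) ((R ^^ j) x))) + real r * C)"
      using False by (intro add_mono lin blocks) auto
    also have "\<dots> = (\<Sum>i<q. g N ((R ^^ (j + i * N)) x)) + real (j + r) * C"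
      by (simp add: funpow_add[THEN fun_cong, simplified, symmetric] add.commute algebra_simps)
    finally show ?thesis by (simp add: add.assoc)
  qed
qed

text \<open>As the start \<open>j\<close> runs through \<open>0\<close> to \<open>N - 1\<close>, the
  points \<open>j + i * N\<close> meet each index below \<open>q * N\<close> exactly once, which
  gives a Birkhoff sum along \<open>R\<close>. The lower bound on \<open>H\<close> pays for
  extending it to length \<open>n\<close>.\<close>

lemma subadditive_cocycle_le_birkhoff_sum:
  assumes sub: "subadditive_cocycle R g" and C: "\<And>x. g 1 x \<le> C" "0 \<le> C"
    and N: "N \<ge> 1" "N \<le> n"
    and H: "\<And>x. g N x \<le> H x" "\<And>x. - M \<le> H x" and M: "0 \<le> M"
  shows "real N * g n x \<le> (\<Sum>k<n. H ((R ^^ k) x)) + 2 * real N * (M + real N * C)"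
proof -
  \<comment> \<open>One block fewer than fits: every start \<open>j < N\<close> then leaves a tail
    of length \<open>N - j + r\<close>, at least 1, and head and tail together have length
    \<open>N + r < 2 * N\<close>.\<close>
  define q where "q = n div N - 1"
  define r where "r = n mod N"
  have "n div N \<ge> 1" using N by (simp add: div_greater_zero_iff Suc_le_eq)
  then have n: "n = q * N + N + r" unfolding q_def r_def
    by (metis add.commute div_mult_mod_eq le_add_diff_inverse2 mult_Suc plus_1_eq_Suc)
  have r: "r < N" using N by (simp add: r_def)
  have "real N * g n x = (\<Sum>j<N. g n x)" by simp
  also have "\<dots> \<le> (\<Sum>j<N. (\<Sum>i<q. H ((R ^^ (j + i * N)) x)) + 2 * real N * C)"
  proof (intro sum_mono)
    fix j assume j: "j \<in> {..<N}"
    have n': "n = j + q * N + (N - j + r)" using n j by auto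
    have "g n x \<le> (\<Sum>i<q. g N ((R ^^ (j + i * N)) x)) + real (j + (N - j + r)) * C"
      using j unfolding n' by (intro subadditive_cocycle_le_blocks[OF sub C(1) N(1)]) auto
    also have "\<dots> \<le> (\<Sum>i<q. H ((R ^^ (j + i * N)) x)) + 2 * real N * C"
      using j r C(2) by (intro add_mono sum_mono H mult_right_mono) auto
    finally show "g n x \<le> (\<Sum>i<q. H ((R ^^ (j + i * N)) x)) + 2 * real N * C" .
  qed
  also have "\<dots> = (\<Sum>i<q. \<Sum>j<N. H ((R ^^ (j + i * N)) x)) + 2 * real N * real N * C"
    by (subst sum.swap) (simp add: sum.distrib)
  also have "(\<Sum>i<q. \<Sum>j<N. H ((R ^^ (j + i * N)) x)) = (\<Sum>k<q * N. H ((R ^^ k) x))"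
  proof -
    have "(\<Sum>j<N. H ((R ^^ (j + i * N)) x)) = (\<Sum>k\<in>{i * N..<i * N + N}. H ((R ^^ k) x))" for i
      using sum.shift_bounds_nat_ivl[of "\<lambda>k. H ((R ^^ k) x)" 0 "i * N" N]
      by (simp add: lessThan_atLeast0 add.commute)
    then show ?thesis using sum.nat_group[of "\<lambda>k. H ((R ^^ k) x)" N q] by simp
  qed
  also have "\<dots> \<le> (\<Sum>k<n. H ((R ^^ k) x)) + 2 * real N * M"
  proof -
    have "- (2 * real N * M) \<le> - real (N + r) * M"
      using r M mult_right_mono[of "real (N + r)" "2 * real N" M] by (simp add: algebra_simps)
    also have "\<dots> = (\<Sum>k\<in>{q * N..<n}. - M)" using n by (simp add: algebra_simps)
    also have "\<dots> \<le> (\<Sum>k\<in>{q * N..<n}. H ((R ^^ k) x))" by (intro sum_mono H)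
    moreover have "(\<Sum>k<q * N. H ((R ^^ k) x)) + (\<Sum>k\<in>{q * N..<n}. H ((R ^^ k) x)) = (\<Sum>k<n. H ((R ^^ k) x))"
      using sum.atLeastLessThan_concat[of 0 "q * N" n "\<lambda>k. H ((R ^^ k) x)"] n
      unfolding lessThan_atLeast0 by simp
    ultimately show ?thesis by linarith
  qed
  finally show ?thesis by (simp add: algebra_simps)
qed

section \<open>Closeness of cocycles away from the discontinuities\<close>

text \<open>The radius is the value of the \<open>N\<close>-th term of the series at norm \<eta>.
  All terms are nonnegative, so that term alone stays below the radius, and
  \<open>r / (1 + r)\<close> increases with \<open>r\<close>.\<close>

lemma cocycle_nbhd_good_set:
  assumes f: "f \<in> bounded_cocycles R" and g: "g \<in> bounded_cocycles R" and N: "N \<ge> 1" and \<eta>: "\<eta> > 0"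
    and nb: "g \<in> cocycle_nbhd \<delta> ((1 / 2 ^ N) * (\<eta> / (1 + \<eta>))) f"
    and x: "x \<in> good_set \<delta> f N"
  shows "\<bar>g N x - f N x\<bar> < \<eta>"
proof -
  define r where "r n = sup_norm_on (good_set \<delta> f n) (\<lambda>x. g n x - f n x)" for n
  define t where "t k = (1 / 2 ^ Suc k) * (r (Suc k) / (1 + r (Suc k)))" for k
  have upper: "\<bar>g n y - f n y\<bar> \<le> r n" if n: "n \<ge> 1" and y: "y \<in> good_set \<delta> f n" for n y
  proof -
    obtain B1 where B1: "\<And>x. \<bar>f n x\<bar> \<le> B1"
      using f n unfolding bounded_cocycles_def bounded_range_iff_abs by blast
    obtain B2 where B2: "\<And>x. \<bar>g n x\<bar> \<le> B2"
      using g n unfolding bounded_cocycles_def bounded_range_iff_abs by blast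
    have "\<bar>g n x - f n x\<bar> \<le> B1 + B2" for x
      using B1[of x] B2[of x] by linarith
    then have "bdd_above ((\<lambda>x. \<bar>g n x - f n x\<bar>) ` good_set \<delta> f n)" by (auto intro!: bdd_aboveI)
    then show ?thesis using y by (auto simp: r_def sup_norm_on_def intro: cSUP_upper)
  qed
  have r0: "0 \<le> r n" if "n \<ge> 1" for n
  proof (cases "good_set \<delta> f n = {}")
    case False
    then show ?thesis using upper[OF that] by (meson abs_ge_zero equals0I order_trans)
  qed (simp add: r_def sup_norm_on_def)
  have t: "0 \<le> t k" "t k \<le> (1 / 2) ^ Suc k" for k
  proof -
    have "0 \<le> r (Suc k) / (1 + r (Suc k))" "r (Suc k) / (1 + r (Suc k)) \<le> 1"
      using r0[of "Suc k"] by auto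
    then have "(1 / 2 ^ Suc k) * 0 \<le> t k" "t k \<le> (1 / 2 ^ Suc k) * 1"
      unfolding t_def by (intro mult_left_mono; simp)+
    then show "0 \<le> t k" "t k \<le> (1 / 2) ^ Suc k" by (simp_all add: power_one_over)
  qed
  \<comment> \<open>Without summability the infinite sum would not control its terms.\<close>
  have "summable (\<lambda>k. (1 / 2 :: real) ^ Suc k)" using sums_summable[OF power_half_series] .
  then have "summable t" by (rule summable_comparison_test'[of _ 0]) (use t in auto)
  \<comment> \<open>The series starts at index 0, so the term for \<open>g N\<close> and
    \<open>f N\<close> sits at \<open>N - 1\<close>.\<close>
  then have "t (N - 1) \<le> (\<Sum>k. t k)" using sum_le_suminf[of t "{N - 1}"] t by auto
  also have "\<dots> < (1 / 2 ^ N) * (\<eta> / (1 + \<eta>))"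
    using nb by (simp add: cocycle_nbhd_def cocycle_dist_def t_def r_def Let_def)
  finally have "(1 / 2 ^ N) * (r N / (1 + r N)) < (1 / 2 ^ N) * (\<eta> / (1 + \<eta>))"
    using N by (simp add: t_def)
  then have "r N / (1 + r N) < \<eta> / (1 + \<eta>)" by (rule mult_left_less_imp_less) simp
  then have "r N < \<eta>" using r0[OF N] \<eta> by (simp add: field_simps)
  then show ?thesis using upper[OF N x] by simp
qed

section \<open>Bumps at the discontinuities and continuous truncations\<close>

lemma infdist_le_on_closure_open_nbhd:
  assumes "x \<in> closure (open_nbhd \<delta> E)"
  shows "infdist x E \<le> \<delta>"
proof -
  have "open_nbhd \<delta> E \<subseteq> {x. infdist x E \<le> \<delta>}"
    by (auto simp: open_nbhd_def intro: infdist_le2 less_imp_le)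
  moreover have "closed {x. infdist x E \<le> \<delta>}" by (intro closed_Collect_le continuous_intros)
  ultimately show ?thesis using closure_minimal assms by blast
qed

lemma open_open_nbhd: "open (open_nbhd \<delta> E)"
proof -
  have "open_nbhd \<delta> E = (\<Union>e\<in>E. ball e \<delta>)" by (auto simp: open_nbhd_def dist_commute)
  then show ?thesis by auto
qed

text \<open>The integrals of the cutoffs tend to the measure of \<open>E\<close>, which is 0, so a
  sufficiently sharp cutoff serves.\<close>

lemma null_set_bump:
  fixes \<mu> :: "'a::metric_space measure" and \<eta> :: real
  assumes "prob_space \<mu>" "sets \<mu> = sets borel" "closed E" "E \<in> null_sets \<mu>" "\<eta> > 0"
  obtains \<delta> \<phi> where "\<delta> > 0" "continuous_on UNIV \<phi>" "\<forall>x. 0 \<le> \<phi> x \<and> \<phi> x \<le> 1"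
    "\<forall>x\<in>closure (open_nbhd \<delta> E). \<phi> x = 1" "integral\<^sup>L \<mu> \<phi> < \<eta>"
proof (cases "E = {}")
  \<comment> \<open>The cutoff of the empty set is constantly 1; here the zero function does, as the
    neighbourhood is empty.\<close>
  case True
  then show ?thesis using assms by (intro that[of 1 "\<lambda>_. 0"]) (auto simp: open_nbhd_def)
next
  case False
  have "(\<lambda>n. \<integral>x. cutoff E n x \<partial>\<mu>) \<longlonglongrightarrow> measure \<mu> E"
    using assms False by (intro integral_cutoff_tendsto) (auto simp: prob_space_def)
  then have "eventually (\<lambda>n. integral\<^sup>L \<mu> (cutoff E n) < \<eta>) sequentially"
    using assms by (intro order_tendstoD(2)[of _ 0]) (auto simp: measure_def null_sets_def)
  then obtain n where n: "n > 0" "integral\<^sup>L \<mu> (cutoff E n) < \<eta>"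
    using eventually_conj[OF _ eventually_gt_at_top[of 0]]
    by (metis (no_types, lifting) eventually_sequentially le_add1 le_add2 zero_less_Suc Suc_le_eq)
  show ?thesis
  proof (rule that[of "1 / real n" "cutoff E n"])
    \<comment> \<open>The constant 2 in \<open>cutoff\<close> keeps it equal to 1 up to distance
      \<open>1 / n\<close> inclusive, not merely on \<open>E\<close>.\<close>
    show "\<forall>x\<in>closure (open_nbhd (1 / real n) E). cutoff E n x = 1"
    proof
      fix x assume "x \<in> closure (open_nbhd (1 / real n) E)"
      then have "real n * infdist x E \<le> 1"
        using infdist_le_on_closure_open_nbhd n(1) by (fastforce simp: field_simps)
      then show "cutoff E n x = 1" by (simp add: cutoff_def)
    qed
  qed (use n continuous_cutoff cutoff_bounds in auto)
qed

text \<open>Near the discontinuities the factor \<open>1 - \<phi>\<close> vanishes on an open set,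
  and elsewhere \<open>u\<close> is continuous. The truncation changes \<open>u\<close> by
  \<open>\<phi> * u\<close>, of absolute value at most \<open>M * \<phi>\<close>.\<close>

lemma almost_continuous_truncation:
  fixes u :: "'a::metric_space \<Rightarrow> real"
  assumes \<mu>: "prob_space \<mu>" "sets \<mu> = sets borel" and u: "almost_continuous \<mu> u"
    and M: "\<And>x. \<bar>u x\<bar> \<le> M" and \<phi>: "continuous_on UNIV \<phi>" "\<forall>x. 0 \<le> \<phi> x \<and> \<phi> x \<le> 1"
      "\<forall>x\<in>closure (open_nbhd \<delta> (closure (discontinuities u))). \<phi> x = 1" and \<delta>: "\<delta> > 0"
  shows "continuous_on UNIV (\<lambda>x. (1 - \<phi> x) * u x)"
    and "(\<integral>x. (1 - \<phi> x) * u x \<partial>\<mu>) \<le> (\<integral>x. u x \<partial>completion \<mu>) + M * (\<integral>x. \<phi> x \<partial>\<mu>)"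
proof -
  interpret prob_space \<mu> by fact
  define E where "E = closure (discontinuities u)"
  let ?F = "\<lambda>x. (1 - \<phi> x) * u x"
  have cont_u: "isCont u x" if "x \<notin> E" for x
    using that closure_subset[of "discontinuities u"] by (auto simp: E_def discontinuities_def)
  have E: "closed E" "E \<in> null_sets \<mu>" using u by (auto simp: E_def almost_continuous_def)
  have "isCont ?F x" for x
  proof (cases "x \<in> E")
    case True
    then have x: "x \<in> open_nbhd \<delta> E" using \<delta> by (force simp: open_nbhd_def)
    have "eventually (\<lambda>y. ?F y = 0) (nhds x)"
      using \<phi>(3) closure_subset[of "open_nbhd \<delta> E"] x
      by (intro eventually_nhds[THEN iffD2] exI[of _ "open_nbhd \<delta> E"]) (auto simp: open_open_nbhd E_def)
    then show ?thesis by (subst isCont_cong[where g="\<lambda>_. 0"]) auto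
  next
    case False
    then show ?thesis using cont_u \<phi>(1) by (auto simp: continuous_on_eq_continuous_at intro!: continuous_intros)
  qed
  then show F: "continuous_on UNIV ?F" by (simp add: continuous_on_eq_continuous_at)
  \<comment> \<open>A Borel version of \<open>u\<close>, changed only on the null set
    \<open>E\<close>; it links the integral over the completion with integrals over \<mu>.\<close>
  define v where "v x = indicator (- E) x *\<^sub>R u x" for x
  have "v \<in> borel_measurable borel" unfolding v_def[abs_def]
    using E cont_u
    by (intro borel_measurable_continuous_on_indicator) (auto simp: continuous_on_eq_continuous_at open_Compl)
  then have v: "v \<in> borel_measurable \<mu>" using \<mu>(2) by (simp cong: measurable_cong_sets)
  have sp: "space \<mu> = UNIV" using sets_eq_imp_space_eq[OF \<mu>(2)] by simp
  have u_meas: "u \<in> borel_measurable (completion \<mu>)"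
  proof (rule measurableI)
    \<comment> \<open>Outside \<open>E\<close> the preimage is that of \<open>v\<close>; inside, any
      subset of a null set is measurable for the completion.\<close>
    fix A :: "real set" assume "A \<in> sets borel"
    then have "v -` A \<inter> - E \<in> sets \<mu>"
      using measurable_sets[OF v, of A] E(1) \<mu>(2) by (auto simp: sp)
    moreover have "u -` A \<inter> space (completion \<mu>) = (v -` A \<inter> - E) \<union> (u -` A \<inter> E)"
      by (auto simp: v_def sp)
    ultimately show "u -` A \<inter> space (completion \<mu>) \<in> sets (completion \<mu>)"
      using E(2) by (metis sets_completionI inf_le2)
  qed simp
  have AE: "AE x in \<mu>. x \<notin> E" using E(2) by (rule AE_not_in)
  have "(\<integral>x. u x \<partial>completion \<mu>) = (\<integral>x. v x \<partial>completion \<mu>)"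
  proof (intro integral_cong_AE u_meas measurable_completion[OF v])
    show "AE x in completion \<mu>. u x = v x"
      using AE_completion[OF AE] by eventually_elim (simp add: v_def)
  qed
  also have "\<dots> = integral\<^sup>L \<mu> v" using v by (rule integral_completion)
  finally have uv: "(\<integral>x. u x \<partial>completion \<mu>) = integral\<^sup>L \<mu> v" .
  have M0: "0 \<le> M" using M[of undefined] by linarith
  have F_le: "\<bar>?F x\<bar> \<le> M" for x
    using mult_mono[of "\<bar>1 - \<phi> x\<bar>" 1 "\<bar>u x\<bar>" M] M[of x] \<phi>(2) by (auto simp: abs_mult)
  have intF: "integrable \<mu> ?F"
    using F F_le \<mu>(2) by (intro integrable_bounded_continuous) (unfold_locales, auto simp: bounded_range_iff_abs)
  have int\<phi>: "integrable \<mu> \<phi>"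
    using \<phi> \<mu>(2) by (intro integrable_bounded_continuous)
      (unfold_locales, auto simp: bounded_range_iff_abs intro!: exI[of _ 1])
  have intv: "integrable \<mu> v"
    using v M M0 by (intro integrable_const_bound[of _ M]) (auto simp: v_def indicator_def)
  have "integral\<^sup>L \<mu> ?F \<le> (\<integral>x. v x + M * \<phi> x \<partial>\<mu>)"
  proof (intro integral_mono_AE)
    show "AE x in \<mu>. ?F x \<le> v x + M * \<phi> x"
      using AE
    proof eventually_elim
      case (elim x)
      have "- u x * \<phi> x \<le> M * \<phi> x" using M[of x] \<phi>(2) by (intro mult_right_mono) auto
      then show ?case using elim by (simp add: v_def algebra_simps)
    qed
  qed (use intF intv int\<phi> in auto)
  also have "\<dots> = integral\<^sup>L \<mu> v + M * integral\<^sup>L \<mu> \<phi>" using intv int\<phi> by simp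
  finally show "integral\<^sup>L \<mu> ?F \<le> (\<integral>x. u x \<partial>completion \<mu>) + M * integral\<^sup>L \<mu> \<phi>" using uv by simp
qed

section \<open>The uniform bound for all nearby cocycles\<close>

theorem theorem3p1:
  fixes R :: "'a::metric_space \<Rightarrow> 'a" and \<mu> :: "'a measure"
    and f :: "nat \<Rightarrow> 'a \<Rightarrow> real" and \<epsilon> :: real
  assumes "compact (UNIV :: 'a set)"
    and "continuous_on UNIV R"
    and "uniquely_ergodic R \<mu>"
    and "f \<in> bounded_cocycles R"
    and "\<And>n. n \<ge> 1 \<Longrightarrow> almost_continuous \<mu> (f n)"
    and "convergent (mean_integral \<mu> f)"
    and "\<epsilon> > 0"
  shows "\<exists>\<delta>>0. \<exists>\<sigma>>0. \<exists>K::nat. \<forall>g \<in> cocycle_nbhd \<delta> \<sigma> f \<inter> bounded_cocycles R.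
           \<forall>n>K. \<forall>x. (1 / real n) * g n x < Lambda \<mu> f + \<epsilon> * max (sup_norm_on UNIV (g 1)) 1"
proof -
  have \<mu>: "prob_space \<mu>" "sets \<mu> = sets borel"
    using assms(3) by (auto simp: uniquely_ergodic_def invariant_prob_def)
  have "mean_integral \<mu> f \<longlonglongrightarrow> Lambda \<mu> f"
    using assms(6) by (simp add: convergent_LIMSEQ_iff Lambda_def)
  \<comment> \<open>Error budget: \<open>\<epsilon> / 8\<close> for the choice of \<open>N\<close>,
    then \<open>\<epsilon> * C / 8\<close> each for the terms with \<eta> and for the ends of the
    orbit, with \<open>C\<close> as defined below.\<close>
  then have "eventually (\<lambda>n. mean_integral \<mu> f n < Lambda \<mu> f + \<epsilon> / 8) sequentially"
    using assms(7) by (intro order_tendstoD(2)) auto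
  then have "eventually (\<lambda>n. n \<ge> 1 \<and> mean_integral \<mu> f n < Lambda \<mu> f + \<epsilon> / 8) sequentially"
    using eventually_ge_at_top[of "1::nat"] by eventually_elim simp
  then obtain N where N: "N \<ge> 1" "mean_integral \<mu> f N < Lambda \<mu> f + \<epsilon> / 8"
    using eventually_happens'[OF sequentially_bot] by blast
  define I where "I = (\<integral>x. f N x \<partial>completion \<mu>)"
  have I: "I < real N * (Lambda \<mu> f + \<epsilon> / 8)"
    using N by (simp add: mean_integral_def I_def field_simps)
  obtain M where M: "\<And>x. \<bar>f N x\<bar> \<le> M"
    using assms(4) N(1) unfolding bounded_cocycles_def bounded_range_iff_abs by blast
  have M0: "0 \<le> M" using M[of undefined] by linarith
  \<comment> \<open>The coefficients of \<eta> below add up to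
    \<open>3 * M + 2 + 2 * real N * C\<close>, at most \<open>C\<close> times the factor in the
    denominator.\<close>
  define \<eta> where "\<eta> = \<epsilon> * real N / (8 * (3 * M + 2 * real N + 2))"
  have \<eta>: "\<eta> > 0" using assms(7) N(1) M0 by (simp add: \<eta>_def)
  have \<eta>_eq: "\<eta> * (3 * M + 2 * real N + 2) = \<epsilon> * real N / 8"
    using M0 by (simp add: \<eta>_def divide_simps)
  let ?E = "closure (discontinuities (f N))"
  have ac: "almost_continuous \<mu> (f N)" using assms(5) N(1) by blast
  obtain \<delta> \<phi> where \<delta>: "\<delta> > 0" and \<phi>: "continuous_on UNIV \<phi>" "\<forall>x. 0 \<le> \<phi> x \<and> \<phi> x \<le> 1"
    "\<forall>x\<in>closure (open_nbhd \<delta> ?E). \<phi> x = 1" "integral\<^sup>L \<mu> \<phi> < \<eta>"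
    using null_set_bump[OF \<mu> _ _ \<eta>, of ?E] ac unfolding almost_continuous_def by auto
  define F where "F x = (1 - \<phi> x) * f N x" for x
  have F: "continuous_on UNIV F" "integral\<^sup>L \<mu> F \<le> I + M * integral\<^sup>L \<mu> \<phi>"
    using almost_continuous_truncation[OF \<mu> ac M \<phi>(1-3) \<delta>] unfolding F_def[abs_def] I_def by auto
  have F_ge: "- M \<le> F x" for x
  proof -
    have "\<bar>F x\<bar> \<le> 1 * M"
      unfolding F_def abs_mult using M[of x] \<phi>(2) by (intro mult_mono) auto
    then show ?thesis by linarith
  qed
  obtain K1 where K1: "\<forall>n\<ge>K1. \<forall>x. (\<Sum>k<n. F ((R ^^ k) x)) \<le> real n * (integral\<^sup>L \<mu> F + \<eta>)"
    by (rule uniquely_ergodic_uniform_upper_bound[OF assms(1-3) F(1) \<eta>])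
  obtain K2 where K2: "\<forall>n\<ge>K2. \<forall>x. (\<Sum>k<n. \<phi> ((R ^^ k) x)) \<le> real n * (integral\<^sup>L \<mu> \<phi> + \<eta>)"
    by (rule uniquely_ergodic_uniform_upper_bound[OF assms(1-3) \<phi>(1) \<eta>])
  \<comment> \<open>For \<open>n\<close> beyond \<open>K3\<close> the end term
    \<open>2 * N * (M + N * C)\<close> is at most \<open>n * N * \<epsilon> * C / 8\<close>.\<close>
  obtain K3 :: nat where K3: "16 * (M + real N) / \<epsilon> \<le> real K3" using real_arch_simple by blast
  define K where "K = K1 + K2 + K3 + N"
  define \<sigma> where "\<sigma> = (1 / 2 ^ N) * (\<eta> / (1 + \<eta>))"
  have \<sigma>: "\<sigma> > 0" using \<eta> by (simp add: \<sigma>_def)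
  have main: "(1 / real n) * g n x < Lambda \<mu> f + \<epsilon> * max (sup_norm_on UNIV (g 1)) 1"
    if g: "g \<in> cocycle_nbhd \<delta> \<sigma> f" "g \<in> bounded_cocycles R" and n: "n > K" for g n x
  proof -
    \<comment> \<open>\<open>C\<close> is the first constant that depends on \<open>g\<close>. Each
      error grows at most linearly in it, and \<open>C\<close> is at least 1, so the earlier choices
      work for all \<open>g\<close> at once.\<close>
    define C where "C = max (sup_norm_on UNIV (g 1)) 1"
    have C1: "1 \<le> C" by (simp add: C_def)
    have gC: "g 1 x \<le> C" for x
    proof -
      obtain B where "\<And>x. \<bar>g 1 x\<bar> \<le> B"
        using g(2) unfolding bounded_cocycles_def bounded_range_iff_abs by blast
      then have "bdd_above (range (\<lambda>x. \<bar>g 1 x\<bar>))" by (auto intro!: bdd_aboveI)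
      then have "\<bar>g 1 x\<bar> \<le> sup_norm_on UNIV (g 1)" by (auto simp: sup_norm_on_def intro: cSUP_upper)
      then show ?thesis by (simp add: C_def)
    qed
    have sub: "subadditive_cocycle R g" using g(2) by (simp add: bounded_cocycles_def)
    \<comment> \<open>Near the discontinuities \<open>real N * C\<close> bounds \<open>g N\<close>;
      away from them \<open>M\<close> pays for replacing \<open>f N\<close> by its truncation
      \<open>F\<close>.\<close>
    define c where "c = M + real N * C"
    have c0: "0 \<le> c" using M0 C1 by (simp add: c_def)
    define H where "H x = F x + (\<eta> + c * \<phi> x)" for x
    have gH: "g N x \<le> H x" for x
    proof (cases "x \<in> closure (open_nbhd \<delta> ?E)")
      case True
      then show ?thesis
        using subadditive_cocycle_le_linear[OF sub gC N(1), of x] \<phi>(3) M0 \<eta>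
        by (simp add: H_def F_def c_def)
    next
      case False
      then have "x \<in> good_set \<delta> f N" by (simp add: good_set_def)
      then have "\<bar>g N x - f N x\<bar> < \<eta>"
        using cocycle_nbhd_good_set[OF assms(4) g(2) N(1) \<eta>] g(1) by (simp add: \<sigma>_def)
      moreover have "f N x * \<phi> x \<le> M * \<phi> x" using M[of x] \<phi>(2) by (intro mult_right_mono) auto
      moreover have "0 \<le> real N * C * \<phi> x" using C1 \<phi>(2) by simp
      ultimately show ?thesis by (simp add: H_def F_def c_def algebra_simps)
    qed
    have H_ge: "- M \<le> H x" for x
    proof -
      have "0 \<le> c * \<phi> x" using c0 \<phi>(2) by simp
      then show ?thesis using F_ge[of x] \<eta> by (simp add: H_def)
    qed
    have n': "n \<ge> N" "n \<ge> K1" "n \<ge> K2" "n \<ge> K3" "n > 0" using n by (auto simp: K_def)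
    have "real N * g n x \<le> (\<Sum>k<n. H ((R ^^ k) x)) + 2 * real N * (M + real N * C)"
      using C1 by (intro subadditive_cocycle_le_birkhoff_sum[OF sub gC _ N(1) n'(1) gH H_ge M0]) simp
    also have "(\<Sum>k<n. H ((R ^^ k) x)) = (\<Sum>k<n. F ((R ^^ k) x)) + (real n * \<eta> + c * (\<Sum>k<n. \<phi> ((R ^^ k) x)))"
      by (simp add: H_def sum.distrib sum_distrib_left)
    \<comment> \<open>The integral of \<phi> is below \<eta>, so both it and the error of its
      Birkhoff average fit into \<open>2 * \<eta>\<close>.\<close>
    also have "\<dots> \<le> real n * (I + M * \<eta> + \<eta>) + (real n * \<eta> + c * (real n * (2 * \<eta>)))"
    proof (intro add_mono mult_left_mono c0)
      have "M * integral\<^sup>L \<mu> \<phi> \<le> M * \<eta>" using \<phi>(4) M0 by (intro mult_left_mono) auto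
      then have "integral\<^sup>L \<mu> F + \<eta> \<le> I + M * \<eta> + \<eta>" using F(2) by simp
      then show "(\<Sum>k<n. F ((R ^^ k) x)) \<le> real n * (I + M * \<eta> + \<eta>)"
        using K1[rule_format, OF n'(2), of x] by (meson mult_left_mono of_nat_0_le_iff order_trans)
      have "integral\<^sup>L \<mu> \<phi> + \<eta> \<le> 2 * \<eta>" using \<phi>(4) by simp
      then show "(\<Sum>k<n. \<phi> ((R ^^ k) x)) \<le> real n * (2 * \<eta>)"
        using K2[rule_format, OF n'(3), of x] by (meson mult_left_mono of_nat_0_le_iff order_trans)
    qed simp_all
    finally have 1: "real N * g n x \<le> real n * (I + (M * \<eta> + 2 * \<eta> + 2 * M * \<eta>) + 2 * \<eta> * real N * C)
        + 2 * real N * (M + real N * C)"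
      by (simp add: c_def algebra_simps)
    have eC: "\<epsilon> \<le> \<epsilon> * C" using mult_left_mono[OF C1, of \<epsilon>] assms(7) by simp
    have 2: "M * \<eta> + 2 * \<eta> + 2 * M * \<eta> \<le> (M * \<eta> + 2 * \<eta> + 2 * M * \<eta>) * C"
    proof -
      have "0 \<le> M * \<eta> + 2 * \<eta> + 2 * M * \<eta>" using M0 \<eta> by simp
      from mult_left_mono[OF C1 this] show ?thesis by simp
    qed
    have "M \<le> M * C" using C1 M0 by (simp add: mult_le_cancel_left1)
    then have 3: "2 * real N * (M + real N * C) \<le> 2 * real N * ((M + real N) * C)"
      by (intro mult_left_mono) (auto simp: algebra_simps)
    have "16 * (M + real N) \<le> real n * \<epsilon>"
    proof -
      have "16 * (M + real N) / \<epsilon> \<le> real n" using K3 n'(4) by (meson of_nat_le_iff order_trans)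
      then show ?thesis using assms(7) by (simp add: divide_le_eq)
    qed
    then have "2 * (M + real N) * (real N * C) \<le> (real n * \<epsilon> / 8) * (real N * C)"
      using C1 by (intro mult_right_mono) auto
    then have 4: "2 * real N * ((M + real N) * C) \<le> real n * (real N * (\<epsilon> * C / 8))"
      by (simp add: algebra_simps)
    have "I + (M * \<eta> + 2 * \<eta> + 2 * M * \<eta>) + 2 * \<eta> * real N * C
        \<le> I + \<eta> * (3 * M + 2 * real N + 2) * C"
      using 2 by (simp add: algebra_simps)
    also have "\<dots> < real N * (Lambda \<mu> f + \<epsilon> / 8 + \<epsilon> * C / 8)"
      using I unfolding \<eta>_eq by (simp add: algebra_simps)
    also have "\<dots> \<le> real N * (Lambda \<mu> f + \<epsilon> * C / 4)"
      using eC by (intro mult_left_mono, linarith, simp)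
    finally have "real n * (I + (M * \<eta> + 2 * \<eta> + 2 * M * \<eta>) + 2 * \<eta> * real N * C)
        < real n * (real N * (Lambda \<mu> f + \<epsilon> * C / 4))"
      using n'(5) by simp
    then have "real N * g n x < real n * (real N * (Lambda \<mu> f + \<epsilon> * C / 4)) + real n * (real N * (\<epsilon> * C / 8))"
      using 1 3 4 by linarith
    also have "\<dots> = real N * (real n * (Lambda \<mu> f + (3 / 8) * (\<epsilon> * C)))" by (simp add: algebra_simps)
    also have "\<dots> \<le> real N * (real n * (Lambda \<mu> f + \<epsilon> * C))"
      using C1 assms(7) by (intro mult_left_mono add_left_mono) auto
    finally have "real N * g n x < real N * (real n * (Lambda \<mu> f + \<epsilon> * C))" .
    then have "g n x < real n * (Lambda \<mu> f + \<epsilon> * C)" using N(1) by simp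
    then show ?thesis using n'(5) by (simp add: C_def field_simps)
  qed
  show ?thesis
    using \<delta> \<sigma> main by blast
qed

end
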